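(* Let $\mathbb{N}^{\mathrm{sf}}$ be the set of square-free integers $t\geq 2$, and let $U=\{t\in\mathbb{N}^{\mathrm{sf}} : t\equiv 1 \pmod 8\}$. Then the relative density $$\delta_{\mathrm{rel}}(U)=\lim_{X\to\infty}\frac{\#\{t\in U: t\leq X\}}{\#\{t\in\mathbb{N}^{\mathrm{sf}}: t\leq X\}}$$ exists and equals $\frac{1}{6}$. Moreover, for every $t\in U$, with $K=\mathbb{Q}(\sqrt{t})$: for all $a,b\in\mathcal{O}_K\setminus\{0\}$ and $c=2^d b-3^r$ with $r,d$ positive integers, $d\geq 2$ and $r$ odd, the equation $ax^d-y^2-z^2+xyz-c=0$ has no solution $(x_0,y_0,z_0)\in\mathcal{O}_K^3$ with $x_0\in 2\mathcal{O}_K$. *)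

theory Defs
  imports
    Complex_Main
    "HOL-Computational_Algebra.Computational_Algebra"
    "HOL-Number_Theory.Cong"
begin

definition sqfree_nats :: "nat set" where
  "sqfree_nats = {t. t \<ge> 2 \<and> squarefree t}"

definition sqfree_1_mod_8 :: "nat set" where
  "sqfree_1_mod_8 = {t \<in> sqfree_nats. [t = 1] (mod 8)}"

definition rel_density_ratio :: "nat set \<Rightarrow> real \<Rightarrow> real" where
  "rel_density_ratio A X =
     real (card {t \<in> A. real t \<le> X}) / real (card {t \<in> sqfree_nats. real t \<le> X})"

text \<open>Since \<open>inverse 0 = 0\<close>, closure under \<open>inverse\<close> need not exclude zero.\<close>

definition is_subfield :: "'a :: field set \<Rightarrow> bool" where
  "is_subfield F \<longleftrightarrow> 0 \<in> F \<and> 1 \<in> F \<and>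
     (\<forall>x\<in>F. \<forall>y\<in>F. x + y \<in> F \<and> x * y \<in> F) \<and>
     (\<forall>x\<in>F. - x \<in> F \<and> inverse x \<in> F)"

text \<open>
  The smallest subfield of the ambient field containing \<open>\<alpha>\<close>. In characteristic 0 it automatically
  contains the rational numbers, so this is the field obtained by adjoining \<open>\<alpha>\<close> to them.
\<close>

definition rat_adjoin :: "'a :: field_char_0 \<Rightarrow> 'a set" where
  "rat_adjoin \<alpha> = \<Inter>{F. is_subfield F \<and> \<alpha> \<in> F}"

definition quadratic_field :: "nat \<Rightarrow> real set" where
  "quadratic_field t = rat_adjoin (sqrt (real t))"

definition ring_of_integers :: "'a :: field_char_0 set \<Rightarrow> 'a set" where
  "ring_of_integers K = {x \<in> K. algebraic_int x}"

lemma is_subfield_of_nat: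
  assumes "is_subfield F"
  shows "of_nat n \<in> F"
  using assms by (induction n) (auto simp: is_subfield_def)

lemma is_subfield_Rats:
  fixes F :: "'a :: field_char_0 set"
  assumes "is_subfield F"
  shows "\<rat> \<subseteq> F"
proof
  fix x :: 'a assume "x \<in> \<rat>"
  then obtain a b where x: "x = of_int a / of_int b"
    by (auto elim!: Rats_cases')
  have "of_int z \<in> F" for z
    using assms is_subfield_of_nat[OF assms]
    by (cases z rule: int_cases2) (auto simp: is_subfield_def)
  thus "x \<in> F"
    using assms by (auto simp: x divide_inverse is_subfield_def)
qed

lemma quadratic_field_eq:
  "quadratic_field t = {p + q * sqrt (real t) | p q. p \<in> \<rat> \<and> q \<in> \<rat>}"
proof -
  define s where "s = sqrt (real t)"
  define K where "K = {p + q * s | p q. p \<in> \<rat> \<and> q \<in> \<rat>}"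
  have ss: "s * s = real t"
    by (simp add: s_def)
  have KI: "x \<in> K" if "x = p + q * s" "p \<in> \<rat>" "q \<in> \<rat>" for x p q
    using that unfolding K_def by blast
  have K0: "p \<in> K" if "p \<in> \<rat>" for p
    by (rule KI[of p p 0]) (simp_all add: that)
  have "is_subfield K"
    unfolding is_subfield_def
  proof (intro conjI ballI)
    fix x y assume "x \<in> K" "y \<in> K"
    then obtain p q p' q' where xy: "x = p + q * s" "y = p' + q' * s"
      and r: "p \<in> \<rat>" "q \<in> \<rat>" "p' \<in> \<rat>" "q' \<in> \<rat>" unfolding K_def by blast
    show "x + y \<in> K"
      by (rule KI[of _ "p + p'" "q + q'"]) (use r in \<open>simp_all add: xy algebra_simps\<close>)
    show "x * y \<in> K"
      by (rule KI[of _ "p * p' + q * q' * real t" "p * q' + q * p'"])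
         (use r in \<open>simp_all add: xy algebra_simps flip: ss\<close>, simp_all add: ss)
  next
    fix x assume "x \<in> K"
    then obtain p q where x: "x = p + q * s" and r: "p \<in> \<rat>" "q \<in> \<rat>"
      unfolding K_def by blast
    show "- x \<in> K"
      by (rule KI[of _ "- p" "- q"]) (use r in \<open>simp_all add: x\<close>)
    define N where "N = p * p - q * q * real t"
    have N: "N = x * (p - q * s)"
      by (simp add: N_def x ss[symmetric] algebra_simps)
    have NQ: "N \<in> \<rat>" using r by (simp add: N_def)
    show "inverse x \<in> K"
    proof (cases "x = 0 \<or> p = q * s")
      case True
      hence "x = 0 \<or> x = p + p" by (auto simp: x)
      thus ?thesis using r by (auto intro!: K0)
    next
      case False
      hence "inverse x = (p - q * s) / N"
        by (simp add: N divide_simps)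
      hence "inverse x = p / N + (- q / N) * s"
        by (simp add: diff_divide_distrib)
      thus ?thesis by (rule KI) (use r NQ in simp_all)
    qed
  qed (simp_all add: K0)
  moreover have "s \<in> K" by (rule KI[of _ 0 1]) simp_all
  ultimately have "quadratic_field t \<subseteq> K"
    unfolding quadratic_field_def rat_adjoin_def s_def by blast
  moreover have "K \<subseteq> F" if "is_subfield F" "s \<in> F" for F
    using that is_subfield_Rats[OF that(1)] unfolding K_def is_subfield_def by blast
  hence "K \<subseteq> quadratic_field t"
    unfolding quadratic_field_def rat_adjoin_def s_def by blast
  ultimately show ?thesis
    unfolding K_def s_def by blast
qed

end

theory Submission
  imports Defs
begin

text \<open>
  Density: let \<open>S\<close> be a set of positive integers of density \<open>\<sigma>\<close> with bounded counting error that is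
  invariant under multiplication and division by \<open>p\<^sup>2\<close>. Discarding the multiples of \<open>p\<^sup>2\<close> for finitely
  many such primes \<open>p\<close> multiplies the density by \<open>\<Prod>(1 - 1/p\<^sup>2)\<close> and keeps the error bounded, while
  the primes above \<open>y\<close> affect only a proportion of at most \<open>1/y\<close>. Let \<open>L\<close> be the product over all odd
  primes. As odd squares are 1 modulo 8, the class of 1 modulo 8 has squarefree density \<open>L/8\<close>, whereas
  all squarefree numbers have density \<open>3L/4\<close>.

  Equation: if \<open>t\<close> is 1 modulo 8, then 2 splits, so the ring of integers maps onto the integers
  modulo 4. For \<open>x = 2 u\<close> the equation becomes \<open>y\<^sup>2 + z\<^sup>2 - 2 u y z = 3\<close> there, which is
  impossible since the left-hand side is \<open>y\<^sup>2 + z\<^sup>2\<close> or \<open>(y - z)\<^sup>2\<close> according to the parity of \<open>u\<close>.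
\<close>

section \<open>Relative density\<close>

text \<open>The cutoff is real so that \<open>X / k\<close> is again a cutoff, as scaling a set by
  \<open>k\<close> requires; \<open>rel_density_ratio\<close> is a quotient of two such
  counts.\<close>

definition count_upto :: "nat set \<Rightarrow> real \<Rightarrow> real" where
  "count_upto A X = real (card {t \<in> A. real t \<le> X})"

lemma finite_Collect_real_le [simp]: "finite {t \<in> A. real t \<le> X}"
  by (rule finite_subset[of _ "{..nat \<lfloor>X\<rfloor>}"]) (auto simp: le_nat_floor)

lemma count_upto_mono: "A \<subseteq> B \<Longrightarrow> count_upto A X \<le> count_upto B X"
  unfolding count_upto_def of_nat_le_iff by (rule card_mono) auto

lemma count_upto_Diff:
  assumes "B \<subseteq> A"
  shows "count_upto (A - B) X = count_upto A X - count_upto B X"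
proof -
  have "{t \<in> A - B. real t \<le> X} = {t \<in> A. real t \<le> X} - {t \<in> B. real t \<le> X}" by auto
  moreover have "{t \<in> B. real t \<le> X} \<subseteq> {t \<in> A. real t \<le> X}" using assms by auto
  ultimately show ?thesis
    unfolding count_upto_def by (simp add: card_Diff_subset card_mono of_nat_diff)
qed

lemma count_upto_image_mult:
  assumes "k > 0"
  shows "count_upto ((\<lambda>n. n * k) ` A) X = count_upto A (X / real k)"
proof -
  have "{t \<in> (\<lambda>n. n * k) ` A. real t \<le> X} = (\<lambda>n. n * k) ` {t \<in> A. real t \<le> X / real k}"
    using assms by (auto simp: field_simps)
  moreover have "inj_on (\<lambda>n. n * k) {t \<in> A. real t \<le> X / real k}"
    using assms by (auto simp: inj_on_def)
  ultimately show ?thesis by (simp add: count_upto_def card_image)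
qed

lemma count_upto_UNION_le:
  assumes "finite I"
  shows "count_upto (\<Union>i\<in>I. A i) X \<le> (\<Sum>i\<in>I. count_upto (A i) X)"
proof -
  have "{t \<in> (\<Union>i\<in>I. A i). real t \<le> X} = (\<Union>i\<in>I. {t \<in> A i. real t \<le> X})" by auto
  thus ?thesis
    using card_UN_le[OF assms, of "\<lambda>i. {t \<in> A i. real t \<le> X}"]
    by (simp add: count_upto_def flip: of_nat_sum)
qed

lemma count_upto_pos:
  assumes "X \<ge> 0"
  shows "count_upto {0<..} X = real_of_int \<lfloor>X\<rfloor>"
proof -
  have "{t \<in> {0<..}. real t \<le> X} = {1..nat \<lfloor>X\<rfloor>}"
    using assms by (auto simp: le_nat_floor) linarith
  thus ?thesis using assms by (simp add: count_upto_def)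
qed

lemma count_upto_1_mod_8:
  assumes "X \<ge> 0"
  shows "\<bar>count_upto {n. n mod 8 = 1} X - X / 8\<bar> \<le> 1"
proof -
  define N where "N = nat \<lfloor>X\<rfloor>"
  have N: "real N \<le> X" "X < real N + 1" using assms unfolding N_def by linarith+
  \<comment> \<open>\<open>(N + 7) div 8\<close> is \<open>N / 8\<close> rounded up, the number of
    \<open>i\<close> with \<open>8 * i + 1 \<le> N\<close>.\<close>
  have "{t \<in> {n. n mod 8 = 1}. real t \<le> X} = (\<lambda>i. 8 * i + 1) ` {..<(N + 7) div 8}"
  proof (intro equalityI subsetI)
    fix t assume t: "t \<in> {t \<in> {n. n mod 8 = 1}. real t \<le> X}"
    hence "t mod 8 = 1" by blast
    hence "t = 8 * (t div 8) + 1" by presburger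
    moreover have "t \<le> N" using t by (simp add: N_def le_nat_floor)
    ultimately show "t \<in> (\<lambda>i. 8 * i + 1) ` {..<(N + 7) div 8}" by (intro image_eqI) auto
  next
    fix t assume "t \<in> (\<lambda>i. 8 * i + 1) ` {..<(N + 7) div 8}"
    then obtain i where "t = 8 * i + 1" "i < (N + 7) div 8" by blast
    hence "t mod 8 = 1" "t \<le> N" by presburger+
    thus "t \<in> {t \<in> {n. n mod 8 = 1}. real t \<le> X}" using N by simp
  qed
  moreover have "inj_on (\<lambda>i::nat. 8 * i + 1) {..<(N + 7) div 8}" by (auto simp: inj_on_def)
  ultimately have "count_upto {n. n mod 8 = 1} X = real ((N + 7) div 8)"
    by (simp add: count_upto_def card_image)
  moreover have "N + 7 = 8 * ((N + 7) div 8) + (N + 7) mod 8" "(N + 7) mod 8 < 8" by simp_all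
  hence "real N \<le> 8 * real ((N + 7) div 8)" "8 * real ((N + 7) div 8) \<le> real N + 7" by linarith+
  ultimately show ?thesis using N by linarith
qed

section \<open>Sieving by the squares of finitely many primes\<close>

definition square_sieve :: "nat set \<Rightarrow> nat set \<Rightarrow> nat set" where
  "square_sieve S P = {n \<in> S. \<forall>p\<in>P. \<not> p ^ 2 dvd n}"

text \<open>Removing the multiples of \<open>p\<^sup>2\<close> scales the density by \<open>1 - 1/p\<^sup>2\<close>, since the
  removed elements are exactly \<open>p\<^sup>2\<close> times the elements of the previous sieved set.\<close>

lemma square_sieve_insert:
  assumes p: "prime p" "p \<notin> P" and P: "\<And>q. q \<in> P \<Longrightarrow> prime q"
    and S: "\<And>n. n * p ^ 2 \<in> S \<longleftrightarrow> n \<in> S"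
  shows "square_sieve S (insert p P) = square_sieve S P - (\<lambda>n. n * p ^ 2) ` square_sieve S P"
    and "(\<lambda>n. n * p ^ 2) ` square_sieve S P \<subseteq> square_sieve S P"
proof -
  have *: "n * p ^ 2 \<in> square_sieve S P \<longleftrightarrow> n \<in> square_sieve S P" for n
  proof -
    have "q ^ 2 dvd n * p ^ 2 \<longleftrightarrow> q ^ 2 dvd n" if "q \<in> P" for q
    proof -
      have "coprime q p" using P[OF that] p that by (metis primes_coprime)
      thus ?thesis by (simp add: coprime_dvd_mult_left_iff)
    qed
    thus ?thesis by (simp add: square_sieve_def S)
  qed
  show "(\<lambda>n. n * p ^ 2) ` square_sieve S P \<subseteq> square_sieve S P" using * by blast
  show "square_sieve S (insert p P) = square_sieve S P - (\<lambda>n. n * p ^ 2) ` square_sieve S P"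
  proof (intro equalityI subsetI)
    fix n assume "n \<in> square_sieve S (insert p P)"
    thus "n \<in> square_sieve S P - (\<lambda>n. n * p ^ 2) ` square_sieve S P"
      by (auto simp: square_sieve_def)
  next
    fix n assume n: "n \<in> square_sieve S P - (\<lambda>n. n * p ^ 2) ` square_sieve S P"
    have "\<not> p ^ 2 dvd n"
    proof
      assume "p ^ 2 dvd n"
      then obtain k where "n = k * p ^ 2" by (metis dvdE mult.commute)
      thus False using n * by blast
    qed
    thus "n \<in> square_sieve S (insert p P)" using n by (auto simp: square_sieve_def)
  qed
qed

text \<open>Each new prime replaces the count at \<open>X\<close> by the difference of the previous
  counts at \<open>X\<close> and \<open>X / p^2\<close>. This multiplies the main term by
  \<open>1 - 1 / p^2\<close> and at most doubles the error bound. The bound is uniform in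
  \<open>X\<close> but not in \<open>P\<close>, which suffices because \<open>P\<close> stays fixed
  while \<open>X\<close> grows.\<close>

lemma count_square_sieve:
  assumes fin: "finite P" and P: "\<And>p. p \<in> P \<Longrightarrow> prime p"
    and S: "\<And>n p. p \<in> P \<Longrightarrow> n * p ^ 2 \<in> S \<longleftrightarrow> n \<in> S"
    and dens: "\<And>X. X \<ge> 0 \<Longrightarrow> \<bar>count_upto S X - \<sigma> * X\<bar> \<le> B"
  shows "\<exists>B. \<forall>X\<ge>0. \<bar>count_upto (square_sieve S P) X - \<sigma> * (\<Prod>p\<in>P. 1 - 1 / real p ^ 2) * X\<bar> \<le> B"
  using fin P S
proof (induction P rule: finite_induct)
  case empty
  show ?case using dens by (auto simp: square_sieve_def)
next
  case (insert p P)
  define c where "c = \<sigma> * (\<Prod>p\<in>P. 1 - 1 / real p ^ 2)"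
  obtain B where B: "\<bar>count_upto (square_sieve S P) X - c * X\<bar> \<le> B" if "X \<ge> 0" for X
    using insert.IH insert.prems unfolding c_def by (metis insertI2)
  have p: "prime p" "p > 0" using insert.prems(1)[of p] by (auto simp: prime_gt_0_nat)
  note ins = square_sieve_insert[of p P S, OF p(1) insert.hyps(2) insert.prems(1) insert.prems(2)]
  have "\<bar>count_upto (square_sieve S (insert p P)) X -
          \<sigma> * (\<Prod>p\<in>insert p P. 1 - 1 / real p ^ 2) * X\<bar> \<le> 2 * B" if X: "X \<ge> 0" for X
  proof -
    have 1: "count_upto (square_sieve S (insert p P)) X =
        count_upto (square_sieve S P) X - count_upto (square_sieve S P) (X / real p ^ 2)"
      using ins p by (simp add: count_upto_Diff count_upto_image_mult)
    have 2: "\<sigma> * (\<Prod>p\<in>insert p P. 1 - 1 / real p ^ 2) * X = c * X - c * (X / real p ^ 2)"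
      using insert.hyps by (simp add: c_def algebra_simps)
    have "X / real p ^ 2 \<ge> 0" using X by simp
    moreover have "\<bar>(u - v) - (w - z)\<bar> \<le> 2 * B"
      if "\<bar>u - w\<bar> \<le> B" "\<bar>v - z\<bar> \<le> B" for u v w z :: real
      using that by linarith
    ultimately show ?thesis unfolding 1 2 using B X by blast
  qed
  thus ?case by blast
qed

section \<open>The contribution of the large primes and the resulting density\<close>

text \<open>Telescoping: \<open>1 / m^2\<close> is at most
  \<open>1 / (m - 1) - 1 / m\<close>.\<close>

lemma sum_inverse_squares_le:
  assumes "y > 0"
  shows "(\<Sum>m\<in>{y<..M}. 1 / real m ^ 2) \<le> 1 / real y"
proof (cases "y \<le> M")
  case True
  have "(\<Sum>m\<in>{y<..M}. 1 / real m ^ 2) \<le> 1 / real y - 1 / real M"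
    using True
  proof (induction M rule: dec_induct)
    case base
    show ?case by simp
  next
    case (step n)
    have "{y<..Suc n} = insert (Suc n) {y<..n}" using step by auto
    moreover have "1 / real (Suc n) ^ 2 \<le> 1 / (real n * real (Suc n))"
      unfolding power2_eq_square using step assms by (intro divide_left_mono mult_right_mono) auto
    moreover have "1 / (real n * real (Suc n)) = 1 / real n - 1 / real (Suc n)"
      using step assms by (simp add: divide_simps)
    ultimately show ?case using step.IH by simp
  qed
  thus ?thesis by (smt (verit) divide_nonneg_nonneg of_nat_0_le_iff)
qed simp

text \<open>An element that survives the sieve without being squarefree is divisible by
  \<open>p^2\<close> for some prime \<open>p > y\<close>, because \<open>Q\<close> contains every
  prime whose square divides an element of \<open>S\<close>. The multiples of \<open>m^2\<close> for
  all integers \<open>m > y\<close> are counted instead, at most \<open>X / m^2\<close> for each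
  \<open>m\<close>.\<close>

lemma square_sieve_tail:
  assumes y: "y > 0" and S: "S \<subseteq> {0<..}" and X: "X \<ge> 0"
    and Q: "\<And>p n. prime p \<Longrightarrow> n \<in> S \<Longrightarrow> p ^ 2 dvd n \<Longrightarrow> p \<in> Q"
  shows "\<bar>count_upto {n \<in> S. squarefree n} X -
     count_upto (square_sieve S {p \<in> Q. prime p \<and> p \<le> y}) X\<bar> \<le> X / real y"
proof -
  define T where "T = square_sieve S {p \<in> Q. prime p \<and> p \<le> y}"
  define F where "F = {n \<in> S. squarefree n}"
  define M where "M = nat \<lfloor>X\<rfloor>"
  have FT: "F \<subseteq> T"
    using squarefreeD not_prime_unit unfolding F_def T_def square_sieve_def by blast
  \<comment> \<open>Since \<open>p \<le> p^2 \<le> n \<le> X\<close>, only moduli up to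
    \<open>M\<close> occur, which keeps the union finite.\<close>
  have sub: "{n \<in> T - F. real n \<le> X} \<subseteq>
     {n \<in> (\<Union>m\<in>{y<..M}. (\<lambda>n. n * m ^ 2) ` {0<..}). real n \<le> X}"
  proof safe
    fix n assume n: "n \<in> T" "n \<notin> F" "real n \<le> X"
    have nS: "n \<in> S" using n by (simp add: T_def square_sieve_def)
    hence n0: "n > 0" using S by auto
    have "\<not> squarefree n" using n nS by (simp add: F_def)
    then obtain p where p: "prime p" "p ^ 2 dvd n"
      using n0 by (auto simp: squarefree_factorial_semiring)
    have "p > y"
      using n(1) p Q[OF p(1) nS p(2)] by (auto simp: T_def square_sieve_def)
    obtain k where k: "n = k * p ^ 2" using p(2) by (metis dvdE mult.commute)
    hence "k > 0" using n0 by auto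
    have "p \<le> p ^ 2" by (simp add: power2_eq_square)
    also have "\<dots> \<le> n" using p(2) n0 by (rule dvd_imp_le)
    also have "n \<le> M" using n(3) by (simp add: M_def le_nat_floor)
    finally have "p \<in> {y<..M}" using \<open>p > y\<close> by simp
    thus "n \<in> (\<Union>m\<in>{y<..M}. (\<lambda>n. n * m ^ 2) ` {0<..})" using k \<open>k > 0\<close> by blast
  qed
  have "count_upto (T - F) X \<le> count_upto (\<Union>m\<in>{y<..M}. (\<lambda>n. n * m ^ 2) ` {0<..}) X"
    unfolding count_upto_def of_nat_le_iff by (rule card_mono[OF finite_Collect_real_le sub])
  also have "\<dots> \<le> (\<Sum>m\<in>{y<..M}. count_upto ((\<lambda>n. n * m ^ 2) ` {0<..}) X)"
    by (rule count_upto_UNION_le) simp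
  also have "\<dots> \<le> (\<Sum>m\<in>{y<..M}. X * (1 / real m ^ 2))"
  proof (rule sum_mono)
    fix m assume "m \<in> {y<..M}"
    hence "m > 0" by simp
    thus "count_upto ((\<lambda>n. n * m ^ 2) ` {0<..}) X \<le> X * (1 / real m ^ 2)"
      using X by (simp add: count_upto_image_mult count_upto_pos)
  qed
  also have "\<dots> = X * (\<Sum>m\<in>{y<..M}. 1 / real m ^ 2)" by (simp add: sum_distrib_left)
  also have "\<dots> \<le> X * (1 / real y)"
    using X by (intro mult_left_mono sum_inverse_squares_le[OF y])
  finally have "count_upto (T - F) X \<le> X / real y" by simp
  moreover have "count_upto (T - F) X = count_upto T X - count_upto F X"
    by (rule count_upto_Diff[OF FT])
  moreover have "count_upto F X \<le> count_upto T X" by (rule count_upto_mono[OF FT])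
  ultimately show ?thesis unfolding T_def F_def by linarith
qed

text \<open>The order of the choices matters: first \<open>y\<close> is fixed so that the truncated
  product and the tail \<open>1 / y\<close> are each within \<open>e / 3\<close>, then
  \<open>X\<close> grows until the sieve error, whose bound depends on \<open>y\<close>, is below
  \<open>e / 3\<close> as well. The parameter \<open>Q\<close> allows all primes for the positive
  integers and the odd primes for the class of 1 modulo 8.\<close>

lemma squarefree_density:
  assumes S: "S \<subseteq> {0<..}"
    and Q: "\<And>p n. prime p \<Longrightarrow> n \<in> S \<Longrightarrow> p ^ 2 dvd n \<Longrightarrow> p \<in> Q"
    and mult: "\<And>n p. p \<in> Q \<Longrightarrow> prime p \<Longrightarrow> n * p ^ 2 \<in> S \<longleftrightarrow> n \<in> S"
    and dens: "\<And>X. X \<ge> 0 \<Longrightarrow> \<bar>count_upto S X - \<sigma> * X\<bar> \<le> B"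
    and lim: "(\<lambda>y. \<Prod>p | p \<in> Q \<and> prime p \<and> p \<le> y. 1 - 1 / real p ^ 2) \<longlonglongrightarrow> L"
  shows "((\<lambda>X. count_upto {n \<in> S. squarefree n} X / X) \<longlongrightarrow> \<sigma> * L) at_top"
proof (rule tendstoI)
  fix e :: real assume e: "e > 0"
  define \<pi> where "\<pi> = (\<lambda>y. \<Prod>p | p \<in> Q \<and> prime p \<and> p \<le> y. 1 - 1 / real p ^ 2)"
  have "(\<lambda>y. \<sigma> * \<pi> y) \<longlonglongrightarrow> \<sigma> * L" unfolding \<pi>_def by (intro tendsto_intros lim)
  hence "\<forall>\<^sub>F y in sequentially. dist (\<sigma> * \<pi> y) (\<sigma> * L) < e / 3"
    using e by (intro tendstoD) simp_all
  moreover have "\<forall>\<^sub>F y in sequentially. dist (1 / real y) 0 < e / 3"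
    using e by (intro tendstoD lim_const_over_n) simp_all
  moreover have "\<forall>\<^sub>F y :: nat in sequentially. y > 0" by (rule eventually_gt_at_top)
  ultimately have "\<forall>\<^sub>F y in sequentially.
      dist (\<sigma> * \<pi> y) (\<sigma> * L) < e / 3 \<and> dist (1 / real y) 0 < e / 3 \<and> y > 0"
    by eventually_elim simp
  then obtain y where y: "\<bar>\<sigma> * \<pi> y - \<sigma> * L\<bar> < e / 3" "1 / real y < e / 3" "y > 0"
    by (auto simp: eventually_sequentially dist_real_def)
  define P where "P = {p \<in> Q. prime p \<and> p \<le> y}"
  have "\<exists>B. \<forall>X\<ge>0. \<bar>count_upto (square_sieve S P) X - \<sigma> * (\<Prod>p\<in>P. 1 - 1 / real p ^ 2) * X\<bar> \<le> B"
  proof (rule count_square_sieve[OF _ _ _ dens])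
    show "finite P" by (simp add: P_def)
    show "prime p" if "p \<in> P" for p using that by (simp add: P_def)
    show "n * p ^ 2 \<in> S \<longleftrightarrow> n \<in> S" if "p \<in> P" for n p using that mult by (simp add: P_def)
  qed
  then obtain B' where B': "\<bar>count_upto (square_sieve S P) X - \<sigma> * \<pi> y * X\<bar> \<le> B'" if "X \<ge> 0" for X
    unfolding \<pi>_def P_def by blast
  have "((\<lambda>X. B' / X) \<longlongrightarrow> 0) at_top"
    by (rule tendsto_divide_0[OF tendsto_const filterlim_at_top_imp_at_infinity[OF filterlim_ident]])
  hence "\<forall>\<^sub>F X in at_top. dist (B' / X) 0 < e / 3" using e by (intro tendstoD) simp_all
  moreover have "\<forall>\<^sub>F X :: real in at_top. X > 0" by (rule eventually_gt_at_top)
  ultimately show "\<forall>\<^sub>F X in at_top. dist (count_upto {n \<in> S. squarefree n} X / X) (\<sigma> * L) < e"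
  proof eventually_elim
    case (elim X)
    define q where "q = count_upto {n \<in> S. squarefree n} X"
    define q' where "q' = count_upto (square_sieve S P) X"
    have "\<bar>q - q'\<bar> \<le> X / real y"
      unfolding q_def q'_def P_def using elim by (intro square_sieve_tail y S Q) auto
    hence "\<bar>q - q'\<bar> / X \<le> 1 / real y" using elim y by (simp add: field_simps)
    hence 1: "\<bar>q / X - q' / X\<bar> \<le> 1 / real y" using elim by (simp add: abs_divide flip: diff_divide_distrib)
    have "\<bar>q' - \<sigma> * \<pi> y * X\<bar> \<le> B'" unfolding q'_def using elim by (intro B') simp
    hence "\<bar>q' - \<sigma> * \<pi> y * X\<bar> / X \<le> B' / X" using elim by (intro divide_right_mono) auto
    moreover have "\<bar>q' - \<sigma> * \<pi> y * X\<bar> / X = \<bar>q' / X - \<sigma> * \<pi> y\<bar>"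
    proof -
      have "q' / X - \<sigma> * \<pi> y = (q' - \<sigma> * \<pi> y * X) / X" using elim by (simp add: field_simps)
      thus ?thesis using elim by (simp add: abs_divide)
    qed
    moreover have "B' / X < e / 3" using elim(1) unfolding dist_real_def by linarith
    ultimately show ?case using 1 y unfolding q_def[symmetric] dist_real_def by linarith
  qed
qed

section \<open>Convergence of the Euler product\<close>

text \<open>All factors lie between 0 and 1, so enlarging \<open>P\<close> to \<open>{2..N}\<close>
  can only lower the product, and there it telescopes to \<open>(1 + 1 / N) / 2\<close>.\<close>

lemma euler_product_partial_ge:
  assumes "finite P" "P \<subseteq> {2..N}" "N \<ge> 1"
  shows "(\<Prod>p\<in>P. 1 - 1 / real p ^ 2) \<ge> 1 / 2"
proof -
  have "(\<Prod>n\<in>{2..N}. 1 - 1 / real n ^ 2) = (1 + 1 / real N) / 2"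
    using assms(3)
  proof (induction N rule: dec_induct)
    case (step N)
    have "{2..Suc N} = insert (Suc N) {2..N}" using step by auto
    hence "(\<Prod>n\<in>{2..Suc N}. 1 - 1 / real n ^ 2) =
        (1 - 1 / real (Suc N) ^ 2) * ((1 + 1 / real N) / 2)"
      using step.IH by simp
    also have "\<dots> = (1 + 1 / real (Suc N)) / 2"
      using step by (simp add: divide_simps power2_eq_square) (simp add: algebra_simps)
    finally show ?case .
  qed simp
  hence "1 / 2 \<le> (\<Prod>n\<in>{2..N}. 1 - 1 / real n ^ 2)" by simp
  also have "\<dots> = (\<Prod>n\<in>{2..N} - P. 1 - 1 / real n ^ 2) * (\<Prod>n\<in>P. 1 - 1 / real n ^ 2)"
    using assms by (intro prod.subset_diff) auto
  also have "\<dots> \<le> 1 * (\<Prod>n\<in>P. 1 - 1 / real n ^ 2)"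
    using assms(2) by (intro mult_right_mono prod_le_1 prod_nonneg ballI) (auto simp: field_simps)
  finally show ?thesis by simp
qed

text \<open>The partial products decrease and stay above 1/2. The positive lower bound on
  \<open>L\<close> later allows \<open>L\<close> to be cancelled from the quotient of two
  densities.\<close>

lemma euler_product_convergent:
  fixes Q :: "nat set"
  assumes "\<And>p. p \<in> Q \<Longrightarrow> p \<ge> 2"
  obtains L where "(\<lambda>y. \<Prod>p | p \<in> Q \<and> p \<le> y. 1 - 1 / real p ^ 2) \<longlonglongrightarrow> L" "L \<ge> 1 / 2"
proof -
  define f where "f = (\<lambda>y. \<Prod>p | p \<in> Q \<and> p \<le> y. 1 - 1 / real p ^ 2)"
  \<comment> \<open>The bound is taken to be \<open>Suc y\<close> so that it is at least 1 even for
    \<open>y = 0\<close>.\<close>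
  have ge: "f y \<ge> 1 / 2" for y
    unfolding f_def using assms
    by (intro euler_product_partial_ge[of _ "Suc y"]) (auto intro: finite_subset[of _ "{..y}"])
  have "decseq f"
  proof (rule decseq_SucI)
    fix y
    show "f (Suc y) \<le> f y"
    proof (cases "Suc y \<in> Q")
      case True
      hence "{p. p \<in> Q \<and> p \<le> Suc y} = insert (Suc y) {p. p \<in> Q \<and> p \<le> y}"
        by (auto simp: le_Suc_eq)
      hence "f (Suc y) = (1 - 1 / real (Suc y) ^ 2) * f y" by (simp add: f_def)
      also have "\<dots> \<le> 1 * f y" using ge[of y] by (intro mult_right_mono) auto
      finally show ?thesis by simp
    next
      case False
      hence "{p. p \<in> Q \<and> p \<le> Suc y} = {p. p \<in> Q \<and> p \<le> y}" by (auto simp: le_Suc_eq)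
      thus ?thesis by (simp add: f_def)
    qed
  qed
  then obtain L where "f \<longlonglongrightarrow> L" using decseq_convergent[of f "1 / 2"] ge by blast
  moreover have "L \<ge> 1 / 2" using calculation ge by (intro LIMSEQ_le_const) auto
  ultimately show thesis using that unfolding f_def by blast
qed

section \<open>The relative density 1/6\<close>

lemma rel_density_sqfree_1_mod_8: "(rel_density_ratio sqfree_1_mod_8 \<longlongrightarrow> 1 / 6) at_top"
proof -
  define odd_primes where "odd_primes = {p :: nat. prime p \<and> odd p}"
  obtain L where L: "(\<lambda>y. \<Prod>p | p \<in> odd_primes \<and> p \<le> y. 1 - 1 / real p ^ 2) \<longlonglongrightarrow> L" "L \<ge> 1 / 2"
    by (rule euler_product_convergent[of odd_primes]) (auto simp: odd_primes_def prime_ge_2_nat)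
  \<comment> \<open>The prime 2 supplies the factor \<open>1 - 1/4 = 3/4\<close>, present as soon as
    \<open>y \<ge> 2\<close>.\<close>
  have L_all: "(\<lambda>y. \<Prod>p | p \<in> UNIV \<and> prime p \<and> p \<le> y. 1 - 1 / real p ^ 2) \<longlonglongrightarrow> 3 / 4 * L"
  proof (rule Lim_transform_eventually)
    show "(\<lambda>y. 3 / 4 * (\<Prod>p | p \<in> odd_primes \<and> p \<le> y. 1 - 1 / real p ^ 2)) \<longlonglongrightarrow> 3 / 4 * L"
      by (intro tendsto_intros L)
    show "\<forall>\<^sub>F y in sequentially. 3 / 4 * (\<Prod>p | p \<in> odd_primes \<and> p \<le> y. 1 - 1 / real p ^ 2) =
        (\<Prod>p | p \<in> UNIV \<and> prime p \<and> p \<le> y. 1 - 1 / real p ^ 2)"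
      using eventually_ge_at_top[of 2]
    proof eventually_elim
      case (elim y)
      have "{p. p \<in> UNIV \<and> prime p \<and> p \<le> y} = insert 2 {p. p \<in> odd_primes \<and> p \<le> y}"
        using elim primes_dvd_imp_eq[of "2::nat"] by (auto simp: odd_primes_def)
      thus ?case by (simp add: odd_primes_def)
    qed
  qed
  have dens_all: "((\<lambda>X. count_upto {n \<in> {0<..}. squarefree n} X / X) \<longlongrightarrow> 1 * (3 / 4 * L)) at_top"
  proof (rule squarefree_density[OF _ _ _ _ L_all, where B = 1])
    show "\<bar>count_upto {0<..} X - 1 * X\<bar> \<le> 1" if "X \<ge> 0" for X
      unfolding count_upto_pos[OF that] by linarith
  qed (auto simp: prime_gt_0_nat)
  define S where "S = {n :: nat. n mod 8 = 1}"
  have dens_S: "((\<lambda>X. count_upto {n \<in> S. squarefree n} X / X) \<longlongrightarrow> 1 / 8 * L) at_top"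
  proof (rule squarefree_density[where B = 1 and Q = odd_primes])
    show "S \<subseteq> {0<..}" by (auto simp: S_def intro!: gr0I)
    show "\<bar>count_upto S X - 1 / 8 * X\<bar> \<le> 1" if "X \<ge> 0" for X
      using count_upto_1_mod_8[OF that] by (simp add: S_def)
    show "p \<in> odd_primes" if "prime p" "n \<in> S" "p ^ 2 dvd n" for p n
    proof -
      have "odd n" using that(2) unfolding S_def by simp presburger
      hence "odd p" using that(3) by (meson dvd_power dvd_trans pos2)
      thus ?thesis using that by (simp add: odd_primes_def)
    qed
    show "n * p ^ 2 \<in> S \<longleftrightarrow> n \<in> S" if "p \<in> odd_primes" for n p
    proof -
      have "odd p" using that by (simp add: odd_primes_def)
      then obtain k where "p = 2 * k + 1" by (elim oddE)
      \<comment> \<open>Here \<open>p^2 = 4 * k * (k + 1) + 1\<close>, and one of \<open>k\<close>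
        and \<open>k + 1\<close> is even.\<close>
      moreover obtain j where "k * (k + 1) = 2 * j" by (meson dvdE even_mult_iff odd_add odd_one)
      ultimately have "p ^ 2 = 8 * j + 1" by (simp add: power2_eq_square algebra_simps)
      hence "n * p ^ 2 = n + 8 * (j * n)" by (simp add: algebra_simps)
      thus ?thesis by (simp add: S_def)
    qed
    have "{p \<in> odd_primes. prime p \<and> p \<le> y} = {p \<in> odd_primes. p \<le> y}" for y 
      by (auto simp: odd_primes_def)
    thus "(\<lambda>y. \<Prod>p | p \<in> odd_primes \<and> prime p \<and> p \<le> y. 1 - 1 / real p ^ 2) \<longlonglongrightarrow> L"
      using L by simp
  qed
  \<comment> \<open>The number 1 is squarefree but lies below the range \<open>t \<ge> 2\<close>;
    dropping it changes the quotient by \<open>1 / X\<close>, which tends to 0.\<close>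
  have minus1: "count_upto (A - {1}) X / X = count_upto A X / X - 1 / X" if "1 \<in> A" "X \<ge> 1" for A X
  proof -
    have "{t \<in> {1}. real t \<le> X} = {1}" using that by auto
    hence "count_upto {1} X = 1" by (simp add: count_upto_def)
    thus ?thesis using that by (simp add: count_upto_Diff diff_divide_distrib)
  qed
  have drop1: "((\<lambda>X. count_upto (A - {1}) X / X) \<longlongrightarrow> l) at_top"
    if "((\<lambda>X. count_upto A X / X) \<longlongrightarrow> l) at_top" "1 \<in> A" for A l
  proof (rule Lim_transform_eventually)
    have "((\<lambda>X::real. 1 / X) \<longlongrightarrow> 0) at_top"
      by (rule tendsto_divide_0[OF tendsto_const filterlim_at_top_imp_at_infinity[OF filterlim_ident]])
    from tendsto_diff[OF that(1) this]
    show "((\<lambda>X. count_upto A X / X - 1 / X) \<longlongrightarrow> l) at_top" by simp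
    show "\<forall>\<^sub>F X in at_top. count_upto A X / X - 1 / X = count_upto (A - {1}) X / X"
      using eventually_ge_at_top[of 1] by eventually_elim (use minus1 that in simp)
  qed
  have ge2: "t \<ge> 2 \<longleftrightarrow> t > 0 \<and> t \<noteq> 1" for t :: nat by linarith
  have "t > 0" if "t mod 8 = 1" for t :: nat using that by (cases "t = 0") simp_all
  moreover have "(1::nat) mod 8 = 1" by simp
  ultimately have "sqfree_1_mod_8 = {n \<in> S. squarefree n} - {1}"
    unfolding sqfree_1_mod_8_def sqfree_nats_def S_def cong_def ge2 by (simp only: set_eq_iff) blast
  hence num: "((\<lambda>X. count_upto sqfree_1_mod_8 X / X) \<longlongrightarrow> 1 / 8 * L) at_top"
    using drop1[OF dens_S] by (simp add: S_def)
  have "sqfree_nats = {n \<in> {0<..}. squarefree n} - {1}"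
    unfolding sqfree_nats_def ge2 by blast
  hence den: "((\<lambda>X. count_upto sqfree_nats X / X) \<longlongrightarrow> 3 / 4 * L) at_top"
    using drop1[OF dens_all] by simp
  have "((\<lambda>X. (count_upto sqfree_1_mod_8 X / X) / (count_upto sqfree_nats X / X)) \<longlongrightarrow>
      (1 / 8 * L) / (3 / 4 * L)) at_top"
    using L(2) by (intro tendsto_divide num den) auto
  also have "(1 / 8 * L) / (3 / 4 * L) = 1 / 6" using L(2) by simp
  finally show ?thesis
  proof (rule Lim_transform_eventually)
    show "\<forall>\<^sub>F X in at_top. (count_upto sqfree_1_mod_8 X / X) / (count_upto sqfree_nats X / X) =
        rel_density_ratio sqfree_1_mod_8 X"
      using eventually_gt_at_top[of 0]
      by eventually_elim (simp add: rel_density_ratio_def count_upto_def)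
  qed
qed

section \<open>Integers of the quadratic field\<close>

lemma map_poly_of_int_add:
  "map_poly of_int (p + q) = (map_poly of_int p + map_poly of_int q :: 'a :: comm_ring_1 poly)"
  by (intro poly_eqI) (simp add: coeff_map_poly)

lemma map_poly_of_int_mult:
  "map_poly of_int (p * q) = (map_poly of_int p * map_poly of_int q :: 'a :: comm_ring_1 poly)"
  by (intro poly_eqI) (simp add: coeff_map_poly coeff_mult)

text \<open>Gauss's lemma in the quadratic case: up to a constant \<open>c\<close>, pseudo-division by the primitive
  part leaves no remainder, and comparing contents removes \<open>c\<close>, so the primitive part divides a
  monic integer polynomial.\<close>

lemma is_unit_lead_coeff_primitive_part:
  fixes x :: real and h :: "int poly"
  assumes alg: "algebraic_int x" and irr: "x \<notin> \<rat>"
    and h: "degree h = 2" "poly (map_poly of_int h) x = 0"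
  shows "is_unit (lead_coeff (primitive_part h))"
proof -
  obtain f where f: "poly (map_poly of_int f) x = 0" "lead_coeff f = 1"
    using alg by (auto simp: algebraic_int_altdef_ipoly)
  define m where "m = primitive_part h"
  have h0: "h \<noteq> 0" using h(1) by auto
  have m0: "m \<noteq> 0" using h0 by (simp add: m_def)
  have deg_m: "degree m = 2" using h(1) by (simp add: m_def)
  have cm: "content m = 1" using h0 by (simp add: m_def)
  have hm: "h = smult (content h) m" by (simp add: m_def)
  have "of_int (content h) * poly (map_poly of_int m) x = 0"
    using h(2) by (subst (asm) hm) (simp add: map_poly_smult)
  hence mx: "poly (map_poly of_int m) x = 0" using h0 by simp
  obtain g r where gr: "pseudo_divmod f m = (g, r)" by fastforce
  define c where "c = lead_coeff m ^ (Suc (degree f) - degree m)"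
  have div: "smult c f = m * g + r" "r = 0 \<or> degree r < degree m"
    using pseudo_divmod[OF m0 gr] by (simp_all add: c_def)
  have c0: "c \<noteq> 0" using m0 by (simp add: c_def)
  have "poly (map_poly of_int r) x = 0"
  proof -
    have "poly (map_poly of_int (smult c f)) x = poly (map_poly of_int (m * g + r)) x"
      using div(1) by simp
    thus ?thesis using f(1) mx
      by (simp add: map_poly_smult map_poly_of_int_add map_poly_of_int_mult)
  qed
  \<comment> \<open>A remainder of degree at most 1 that vanishes at the irrational number
    \<open>x\<close> must be zero.\<close>
  moreover have "degree r < 2" using div(2) deg_m by auto
  ultimately have rx: "of_int (coeff r 0) + of_int (coeff r 1) * x = 0"
  proof -
    have "r = [:coeff r 0, coeff r 1:]"
      using \<open>degree r < 2\<close>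
      by (intro poly_eqI) (auto simp: coeff_pCons coeff_eq_0 split: nat.splits)
    hence "map_poly of_int r = [:of_int (coeff r 0), of_int (coeff r 1) :: real:]"
      by (metis map_poly_pCons map_poly_0 of_int_0)
    thus ?thesis using \<open>poly (map_poly of_int r) x = 0\<close> by (simp add: mult.commute)
  qed
  have r1: "coeff r 1 = 0"
  proof (rule ccontr)
    assume nz: "coeff r 1 \<noteq> 0"
    hence "x = - of_int (coeff r 0) / of_int (coeff r 1)"
      using rx by (simp add: field_simps add_eq_0_iff)
    thus False using irr by simp
  qed
  have "r = 0"
    using rx r1 \<open>degree r < 2\<close> 
    by (metis add.right_neutral leading_coeff_0_iff less_2_cases_iff mult_eq_0_iff of_int_0 of_int_eq_0_iff One_nat_def)
  hence "smult c f = m * g" using div by simp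
  hence "content (smult c f) = content g" by (simp add: content_mult cm)
  moreover have "content f = 1"
    using f(2) by (metis content_dvd_coeff dvd_refl is_unit_content_iff)
  ultimately have "content g = normalize c" by simp
  hence "c dvd content g" by simp
  hence "[:c:] dvd g" by (simp add: const_poly_dvd_iff_dvd_content)
  then obtain g' where "g = [:c:] * g'" by blast
  with \<open>smult c f = m * g\<close> have "smult c f = smult c (m * g')" by simp
  hence "f = m * g'" using c0 by (simp only: poly_eq_iff coeff_smult mult_cancel_left) auto
  hence "1 = lead_coeff m * lead_coeff g'" using f(2) by (simp add: lead_coeff_mult)
  thus ?thesis unfolding m_def by (metis dvdI)
qed

text \<open>Clearing denominators gives \<open>h\<close>, whose leading coefficient
  \<open>b2 * c2\<close> agrees with its content up to a unit because the primitive part has unit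
  leading coefficient. So \<open>b2 * c2\<close> divides every coefficient of \<open>h\<close>, and
  the denominators of \<open>b\<close> and \<open>c\<close> cancel.\<close>

lemma quadratic_algebraic_int_coeffs:
  fixes x b c :: real
  assumes alg: "algebraic_int x" and irr: "x \<notin> \<rat>"
    and bc: "b \<in> \<rat>" "c \<in> \<rat>" and root: "x ^ 2 + b * x + c = 0"
  shows "b \<in> \<int>" "c \<in> \<int>"
proof -
  obtain b1 b2 where b: "b = of_int b1 / of_int b2" "b2 > 0" 
    using bc(1) by (auto elim: Rats_cases')
  obtain c1 c2 where c: "c = of_int c1 / of_int c2" "c2 > 0" 
    using bc(2) by (auto elim: Rats_cases')
  define h where "h = [:c1 * b2, b1 * c2, b2 * c2:]"
  have dh: "degree h = 2" using b c by (simp add: h_def)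
  have "of_int b2 * of_int c2 * (x ^ 2 + b * x + c) = 0" using root by simp
  moreover have "of_int b2 * b = of_int b1" "of_int c2 * c = of_int c1" using b c by simp_all
  ultimately have hx: "poly (map_poly of_int h) x = 0"
    by (simp add: h_def map_poly_pCons power2_eq_square algebra_simps) (metis mult.assoc mult.left_commute)
  have u: "is_unit (lead_coeff (primitive_part h))"
    by (rule is_unit_lead_coeff_primitive_part[OF alg irr dh hx])
  have lc: "lead_coeff h = b2 * c2" using b c by (simp add: h_def)
  have "lead_coeff h = content h * lead_coeff (primitive_part h)"
    by (metis content_times_primitive_part lead_coeff_smult)
  hence "b2 * c2 dvd content h" using u lc
    by (metis dvd_refl mult_dvd_mono mult.right_neutral dvd_mult_unit_iff)
  hence d: "b2 * c2 dvd coeff h n" for n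
    by (meson content_dvd_coeff dvd_trans)
  have "b2 * c2 dvd b1 * c2" using d[of 1] by (simp add: h_def)
  hence "b2 dvd b1" using c by simp
  thus "b \<in> \<int>" using b by (auto elim!: dvdE)
  have "b2 * c2 dvd c1 * b2" using d[of 0] by (simp add: h_def)
  hence "c2 dvd c1" using b by (simp add: mult.commute)
  thus "c \<in> \<int>" using c by (auto elim!: dvdE)
qed

section \<open>Integral coordinates in the ring of integers\<close>

lemma sqrt_squarefree_irrational:
  fixes t :: nat
  assumes "squarefree t" "t \<ge> 2"
  shows "sqrt (real t) \<notin> \<rat>"
proof
  assume "sqrt (real t) \<in> \<rat>"
  hence "sqrt (real t) \<in> \<int>" by (intro rational_algebraic_int_is_int) auto
  then obtain k where k: "sqrt (real t) = of_int k" by (auto elim: Ints_cases)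
  have "real t = of_int k ^ 2" by (simp flip: k)
  hence "real t = real ((nat \<bar>k\<bar>) ^ 2)" by simp
  hence "t = (nat \<bar>k\<bar>) ^ 2" by (simp only: of_nat_eq_iff)
  with assms show False
    by (metis dvd_refl nat_dvd_1_iff_1 one_power2 squarefreeD Suc_1 Suc_n_not_le_n)
qed

text \<open>For \<open>q = u / v\<close> in lowest terms, \<open>v^2\<close> divides
  \<open>u^2 * t\<close>, hence \<open>t\<close>, and squarefreeness leaves only
  \<open>v = 1\<close>.\<close>

lemma rat_square_times_squarefree_int:
  fixes t :: nat and q :: real
  assumes sf: "squarefree t" and q: "q \<in> \<rat>" and int: "q ^ 2 * real t \<in> \<int>"
  shows "q \<in> \<int>"
proof -
  obtain u v where uv: "v > 0" "coprime u v" "q = of_int u / of_int v"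
    using q by (auto elim: Rats_cases')
  obtain k where k: "q ^ 2 * real t = of_int k" using int by (auto elim: Ints_cases)
  have "of_int u ^ 2 * real t = of_int k * (of_int v) ^ 2"
    using k uv by (simp add: field_simps)
  hence "of_int (u ^ 2 * int t) = (of_int (k * v ^ 2) :: real)" by simp
  hence eq: "u ^ 2 * int t = k * v ^ 2" by (simp only: of_int_eq_iff)
  have "v ^ 2 dvd u ^ 2 * int t" by (simp add: eq)
  moreover have "coprime (v ^ 2) (u ^ 2)" using uv by (simp add: coprime_commute)
  ultimately have "v ^ 2 dvd int t" by (simp add: coprime_dvd_mult_right_iff)
  hence "int ((nat v) ^ 2) dvd int t" using uv by simp
  hence "(nat v) ^ 2 dvd t" by (simp only: int_dvd_int_iff)
  hence "nat v dvd 1" using sf by (rule squarefreeD[rotated])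
  hence "v = 1" using uv by simp
  thus ?thesis using uv by simp
qed

text \<open>For \<open>x = p + q * s\<close> with \<open>q\<close> nonzero, the trace
  \<open>m = 2 * p\<close> and the norm \<open>c\<close> are integers, so
  \<open>(2 * q)^2 * t\<close> is an integer and with it \<open>n = 2 * q\<close>. As
  \<open>t\<close> is odd, \<open>n^2 * t = m^2 - 4 * c\<close> forces \<open>m\<close> and
  \<open>n\<close> to have the same parity, which turns \<open>(m + n * s) / 2\<close> into the
  desired form.\<close>

lemma ring_of_integers_cases:
  fixes t :: nat
  assumes t: "t \<in> sqfree_1_mod_8" and x: "x \<in> ring_of_integers (quadratic_field t)"
  obtains m n :: int where "x = of_int m + of_int n * ((1 + sqrt (real t)) / 2)"
proof -
  define s where "s = sqrt (real t)"
  have t': "t \<ge> 2" "squarefree t" "[t = 1] (mod 8)"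
    using t by (auto simp: sqfree_1_mod_8_def sqfree_nats_def)
  have s_irr: "s \<notin> \<rat>" unfolding s_def by (rule sqrt_squarefree_irrational) fact+
  have ss: "s ^ 2 = real t" by (simp add: s_def)
  obtain p q where pq: "x = p + q * s" "p \<in> \<rat>" "q \<in> \<rat>" and alg: "algebraic_int x"
    using x by (auto simp: ring_of_integers_def quadratic_field_eq s_def)
  show thesis
  proof (cases "q = 0")
    case True
    hence "x \<in> \<int>" using pq alg by (intro rational_algebraic_int_is_int) auto
    then obtain k where "x = of_int k" by (auto elim: Ints_cases)
    thus thesis by (intro that[of k 0]) simp
  next
    case False
    have "s = (x - p) / q" using False pq by simp
    hence irr: "x \<notin> \<rat>" using s_irr pq(2,3) by (metis Rats_diff Rats_divide)
    have root: "x ^ 2 + (- 2 * p) * x + (p ^ 2 - q ^ 2 * real t) = 0"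
      unfolding pq(1) ss[symmetric] by (simp add: power2_eq_square algebra_simps)
    have "- 2 * p \<in> \<int>" "p ^ 2 - q ^ 2 * real t \<in> \<int>"
      using quadratic_algebraic_int_coeffs[OF alg irr _ _ root] pq by simp_all
    then obtain m c where m: "2 * p = of_int m" and c: "p ^ 2 - q ^ 2 * real t = of_int c"
      by (auto elim!: Ints_cases)
    have e: "(2 * q) ^ 2 * real t = of_int (m ^ 2 - 4 * c)"
      by (simp add: m[symmetric] c[symmetric] power2_eq_square algebra_simps)
    have "2 * q \<in> \<int>"
    proof (rule rat_square_times_squarefree_int[OF t'(2)])
      show "2 * q \<in> \<rat>" using pq(3) by simp
      show "(2 * q) ^ 2 * real t \<in> \<int>" unfolding e by (rule Ints_of_int)
    qed
    then obtain n where n: "2 * q = of_int n" by (auto elim: Ints_cases)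
    have "of_int (n ^ 2 * int t) = (of_int (m ^ 2 - 4 * c) :: real)"
      using e unfolding n by simp
    hence "n ^ 2 * int t = m ^ 2 - 4 * c" by (simp only: of_int_eq_iff)
    moreover have "even (m ^ 2 - 4 * c) \<longleftrightarrow> even m" by simp
    moreover have "t mod 8 = 1" using t'(3) by (simp add: cong_def)
    hence "odd t" by presburger
    hence "even (n ^ 2 * int t) \<longleftrightarrow> even n" by simp
    ultimately have "even (m - n)" by simp
    then obtain k where k: "m - n = 2 * k" by blast
    have "x = of_int k + of_int n * ((1 + s) / 2)"
    proof -
      have "of_int (m - n) = (2 * of_int k :: real)" using k by simp
      thus ?thesis using pq(1) m n by (simp add: field_simps)
    qed
    thus thesis by (intro that[of k n]) (simp add: s_def)
  qed
qed

section \<open>Residues modulo 4\<close>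

text \<open>Reduction modulo the square of a prime above 2: writing \<open>t = 8 e + 1\<close>, the generator
  \<open>w = (1 + \<surd>t) / 2\<close> satisfies \<open>w\<^sup>2 = w + 2 e\<close>, and \<open>2 e\<close> is a root of this equation modulo 4,
  so \<open>m + n w \<mapsto> m + 2 e n\<close> is a ring homomorphism to the integers modulo 4.\<close>

definition has_residue :: "nat \<Rightarrow> real \<Rightarrow> int \<Rightarrow> bool" where
  "has_residue t x k \<longleftrightarrow> (\<exists>m n. x = of_int m + of_int n * ((1 + sqrt (real t)) / 2) \<and>
     [k = m + 2 * (int t div 8) * n] (mod 4))"

lemma has_residue_ex:
  assumes "t \<in> sqfree_1_mod_8" "x \<in> ring_of_integers (quadratic_field t)"
  shows "\<exists>k. has_residue t x k"
  using ring_of_integers_cases[OF assms] unfolding has_residue_def by (metis cong_refl)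

lemma has_residue_of_int: "has_residue t (of_int k) k"
  unfolding has_residue_def by (rule exI[of _ k], rule exI[of _ 0]) simp

lemma has_residue_numeral: "has_residue t (numeral k) (numeral k)"
  using has_residue_of_int[of t "numeral k"] by simp

lemma has_residue_1: "has_residue t 1 1"
  using has_residue_of_int[of t 1] by simp

lemma has_residue_add:
  assumes "has_residue t x k" "has_residue t y l"
  shows "has_residue t (x + y) (k + l)"
proof -
  obtain m n m' n' where *: "x = of_int m + of_int n * ((1 + sqrt (real t)) / 2)"
     "[k = m + 2 * (int t div 8) * n] (mod 4)" "y = of_int m' + of_int n' * ((1 + sqrt (real t)) / 2)"
     "[l = m' + 2 * (int t div 8) * n'] (mod 4)"
    using assms by (auto simp: has_residue_def)
  show ?thesis
    unfolding has_residue_def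
    using cong_add[OF *(2,4)] *(1,3)
    by (intro exI[of _ "m + m'"] exI[of _ "n + n'"]) (simp add: algebra_simps add_divide_distrib)
qed

lemma has_residue_mult:
  assumes t: "[t = 1] (mod 8)" and "has_residue t x k" "has_residue t y l"
  shows "has_residue t (x * y) (k * l)"
proof -
  define e where "e = int t div 8"
  define w where "w = (1 + sqrt (real t)) / 2"
  have "t mod 8 = 1" using t by (simp add: cong_def)
  hence te: "int t = 8 * e + 1" unfolding e_def by presburger
  have "real t = of_int (int t)" by simp
  hence "real t = 8 * of_int e + 1" unfolding te by simp
  moreover have "(sqrt (real t)) ^ 2 = real t" by simp
  moreover have "sqrt (real t) = 2 * w - 1" by (simp add: w_def field_simps)
  ultimately have "(2 * w - 1) ^ 2 = 8 * of_int e + 1" by metis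
  hence ww: "w * w = w + 2 * of_int e" by (simp add: power2_eq_square algebra_simps)
  obtain m n m' n' where *: "x = of_int m + of_int n * w"
     "[k = m + 2 * e * n] (mod 4)" "y = of_int m' + of_int n' * w"
     "[l = m' + 2 * e * n'] (mod 4)"
    using assms by (auto simp: has_residue_def e_def w_def)
  have "x * y = of_int m * of_int m' + (of_int m * of_int n' + of_int m' * of_int n) * w
      + of_int n * of_int n' * (w * w)"
    unfolding * by (simp add: algebra_simps)
  hence xy: "x * y = of_int (m * m' + 2 * e * n * n') + of_int (m * n' + m' * n + n * n') * w"
    by (simp add: ww algebra_simps)
  have "[k * l = (m + 2 * e * n) * (m' + 2 * e * n')] (mod 4)"
    using *(2,4) by (rule cong_mult)
  \<comment> \<open>The last term is the defect of \<open>2 * e\<close> as a root: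
    \<open>(2 * e)^2 - 2 * e - 2 * e = 4 * (e * e - e)\<close>.\<close>
  also have "(m + 2 * e * n) * (m' + 2 * e * n') =
      (m * m' + 2 * e * n * n') + 2 * e * (m * n' + m' * n + n * n') + 4 * ((e * e - e) * n * n')"
    by (simp add: algebra_simps)
  also have "[\<dots> = (m * m' + 2 * e * n * n') + 2 * e * (m * n' + m' * n + n * n')] (mod 4)"
    by (simp add: cong_def)
  finally show ?thesis
    unfolding has_residue_def e_def[symmetric] w_def[symmetric] using xy by blast
qed

lemma has_residue_diff:
  assumes "[t = 1] (mod 8)" "has_residue t x k" "has_residue t y l"
  shows "has_residue t (x - y) (k - l)"
  using has_residue_add[OF assms(2) has_residue_mult[OF assms(1) has_residue_of_int[of t "-1"] assms(3)]]
  by simp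

lemma has_residue_power:
  assumes "[t = 1] (mod 8)" "has_residue t x k"
  shows "has_residue t (x ^ n) (k ^ n)"
  by (induction n) (auto intro: has_residue_1 has_residue_mult assms)

text \<open>Irrationality of the square root forces \<open>m = n = 0\<close> in any representation
  of 0. Since \<open>has_residue\<close> is a relation and not a function, this is where uniqueness
  of the coordinates enters.\<close>

lemma has_residue_0:
  assumes t: "t \<in> sqfree_1_mod_8" and "has_residue t 0 k"
  shows "4 dvd k"
proof -
  obtain m n where mn: "0 = of_int m + of_int n * ((1 + sqrt (real t)) / 2)"
     and k: "[k = m + 2 * (int t div 8) * n] (mod 4)"
    using assms by (auto simp: has_residue_def)
  have irr: "sqrt (real t) \<notin> \<rat>"
    using t by (intro sqrt_squarefree_irrational) (auto simp: sqfree_1_mod_8_def sqfree_nats_def)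
  have "n = 0"
  proof (rule ccontr)
    assume "n \<noteq> 0"
    hence "sqrt (real t) = - of_int (2 * m) / of_int n - 1" using mn by (simp add: field_simps)
    thus False using irr by simp
  qed
  thus ?thesis using mn k by (simp add: cong_0_iff)
qed

section \<open>The equation modulo 4\<close>

text \<open>Both terms containing \<open>2 ^ d\<close> vanish modulo 4, and \<open>3 ^ r\<close> is
  3 for odd \<open>r\<close>. What remains would make a square or a sum of two squares congruent to
  3, while squares are 0 or 1 modulo 4.\<close>

lemma equation_not_0_mod_4:
  fixes A B U Y Z :: int
  assumes d: "d \<ge> 2" and r: "odd r"
  shows "\<not> 4 dvd A * (2 * U) ^ d - Y ^ 2 - Z ^ 2 + 2 * U * Y * Z - (2 ^ d * B - 3 ^ r)"
proof
  assume *: "4 dvd A * (2 * U) ^ d - Y ^ 2 - Z ^ 2 + 2 * U * Y * Z - (2 ^ d * B - 3 ^ r)"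
  obtain j where j: "d = 2 + j" using d le_Suc_ex by blast
  obtain i where i: "r = 2 * i + 1" using r by (auto elim: oddE)
  have "[(9::int) ^ i = 1 ^ i] (mod 4)" by (intro cong_pow) (simp add: cong_def)
  hence "[3 * 9 ^ i = 3 * (1::int)] (mod 4)" by (intro cong_mult) simp_all
  hence "4 dvd (3::int) ^ r - 3" by (simp add: i power_mult cong_iff_dvd_diff)
  moreover have "(4::int) dvd A * (2 * U) ^ d" "(4::int) dvd 2 ^ d * B" by (simp_all add: j power_add power_mult_distrib)
  ultimately have "4 dvd 3 - Y ^ 2 - Z ^ 2 + 2 * U * Y * Z" using * by presburger
  then obtain k where k: "3 - Y ^ 2 - Z ^ 2 + 2 * U * Y * Z = 4 * k" by blast
  have sq: "\<exists>j. n ^ 2 = 4 * j \<or> n ^ 2 = 4 * j + 1" for n :: int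
  proof (cases "even n")
    case True
    then obtain i where "n = 2 * i" by blast
    thus ?thesis by (intro exI[of _ "i ^ 2"]) (simp add: power2_eq_square)
  next
    case False
    then obtain i where "n = 2 * i + 1" by (elim oddE)
    thus ?thesis by (intro exI[of _ "i ^ 2 + i"]) (simp add: power2_eq_square algebra_simps)
  qed
  show False
  proof (cases "even U")
    case True
    then obtain u where "U = 2 * u" by blast
    hence "3 - Y ^ 2 - Z ^ 2 = 4 * (k - u * Y * Z)" using k by (simp add: algebra_simps)
    thus False using sq[of Y] sq[of Z] by presburger
  next
    case False
    then obtain u where "U = 2 * u + 1" by (elim oddE)
    \<comment> \<open>For odd \<open>U\<close> the mixed term is \<open>2 * Y * Z\<close> modulo 4
      and completes the square.\<close>
    hence "3 - (Y - Z) ^ 2 = 4 * (k - u * Y * Z)"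
      using k by (simp add: algebra_simps power2_eq_square)
    thus False using sq[of "Y - Z"] by presburger
  qed
qed

text \<open>Writing the even coordinate as \<open>2 * u\<close> with \<open>u\<close> integral gives
  it the residue \<open>2 * U\<close>, so a solution would yield integers that satisfy the equation
  modulo 4.\<close>

lemma no_solution_even_x:
  assumes t: "t \<in> sqfree_1_mod_8"
    and OK: "OK = ring_of_integers (quadratic_field t)"
    and mem: "a \<in> OK" "b \<in> OK" "u \<in> OK" "y \<in> OK" "z \<in> OK"
    and d: "d \<ge> 2" and r: "odd r"
  shows "a * (2 * u) ^ d - y ^ 2 - z ^ 2 + 2 * u * y * z - (2 ^ d * b - 3 ^ r) \<noteq> 0"
proof
  assume *: "a * (2 * u) ^ d - y ^ 2 - z ^ 2 + 2 * u * y * z - (2 ^ d * b - 3 ^ r) = 0"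
  have t8: "[t = 1] (mod 8)" using t by (simp add: sqfree_1_mod_8_def)
  obtain A B U Y Z where res: "has_residue t a A" "has_residue t b B" "has_residue t u U"
      "has_residue t y Y" "has_residue t z Z"
    using has_residue_ex[OF t] mem unfolding OK by meson
  \<comment> \<open>These rules follow the syntax of the expression, so its residue is the same
    expression in the residues of \<open>a\<close>, \<open>b\<close>, \<open>u\<close>,
    \<open>y\<close> and \<open>z\<close>.\<close>
  note intros = has_residue_add has_residue_diff[OF t8] has_residue_mult[OF t8]
    has_residue_power[OF t8] has_residue_numeral
  have "has_residue t (a * (2 * u) ^ d - y ^ 2 - z ^ 2 + 2 * u * y * z - (2 ^ d * b - 3 ^ r))
      (A * (2 * U) ^ d - Y ^ 2 - Z ^ 2 + 2 * U * Y * Z - (2 ^ d * B - 3 ^ r))"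
    by (intro intros res)
  thus False
    unfolding * using has_residue_0[OF t] equation_not_0_mod_4[OF d r] by blast
qed

theorem theorem2p5:
  shows "(rel_density_ratio sqfree_1_mod_8 \<longlongrightarrow> 1 / 6) at_top \<and>
    (\<forall>t \<in> sqfree_1_mod_8. \<forall>OK. OK = ring_of_integers (quadratic_field t) \<longrightarrow>
      (\<forall>a \<in> OK - {0}. \<forall>b \<in> OK - {0}. \<forall>(r::nat) (d::nat) c.
         r > 0 \<longrightarrow> d > 0 \<longrightarrow> d \<ge> 2 \<longrightarrow> odd r \<longrightarrow> c = 2 ^ d * b - 3 ^ r \<longrightarrow>
         \<not> (\<exists>x \<in> OK. \<exists>y \<in> OK. \<exists>z \<in> OK.
              x \<in> {2 * u | u. u \<in> OK} \<and>
              a * x ^ d - y ^ 2 - z ^ 2 + x * y * z - c = 0)))"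
proof (intro conjI ballI allI impI notI)
  show "(rel_density_ratio sqfree_1_mod_8 \<longlongrightarrow> 1 / 6) at_top"
    by (rule rel_density_sqfree_1_mod_8)
next
  fix t OK a b and r d :: nat and c :: real
  assume *: "t \<in> sqfree_1_mod_8" "OK = ring_of_integers (quadratic_field t)"
    "a \<in> OK - {0}" "b \<in> OK - {0}" "d \<ge> 2" "odd r" "c = 2 ^ d * b - 3 ^ r"
    "\<exists>x\<in>OK. \<exists>y\<in>OK. \<exists>z\<in>OK. x \<in> {2 * u |u. u \<in> OK} \<and>
       a * x ^ d - y ^ 2 - z ^ 2 + x * y * z - c = 0"
  then obtain u y z where sol: "u \<in> OK" "y \<in> OK" "z \<in> OK"
    "a * (2 * u) ^ d - y ^ 2 - z ^ 2 + 2 * u * y * z - c = 0"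
    by blast
  have "a \<in> OK" "b \<in> OK" using *(3,4) by simp_all
  from no_solution_even_x[OF *(1,2) this sol(1-3) *(5,6)] show False
    using sol(4) unfolding *(7) by contradiction
qed

end
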